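(* Let $\mathcal{A}$ be a complex unital Banach algebra and let $x_1,x_2,x_3\in\mathcal{A}$ satisfy $$x_1x_2+x_1x_3+x_2x_3=\alpha_1+\alpha_2(x_1+x_2+x_3)\quad\text{and}\quad x_1x_2x_3=\beta(x_1+x_2+x_3)$$ for some $(\alpha_1,\alpha_2,\beta)\in\mathbb{C}^3\setminus\mathcal{M}$, where $$\mathcal{M}=\{(\alpha_1,\alpha_2,0):\alpha_1,\alpha_2\in\mathbb{C},\ \alpha_1\alpha_2\neq0\}\cup\{(\alpha_1,0,0):\alpha_1\in\mathbb{C}\setminus\{0\}\}.$$ Let $X=\{x_1,x_2,x_3,x_1+x_2+x_3\}$. If any three of the four elements of $X$ are Drazin invertible, then the remaining one is also Drazin invertible.
   Context: $\mathcal{A}$ is a complex unital Banach algebra with unit $1$ (scalars $\lambda$ are identified with $\lambda 1$). An element $a\in\mathcal{A}$ is Drazin invertible if there exists $b\in\mathcal{A}$ (the Drazin inverse, denoted $a^d$) with $ab=ba$, $bab=b$, and $(a(1-ab))^n=0$ for some $n\in\mathbb{N}$; the smallest such $n$ is the Drazin index $i(a)$. $\mathcal{A}^d$ denotes the set of Drazin invertible elements. *)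

theory Defs
  imports "HOL-Analysis.Analysis"
begin

class scaleC =
  fixes scaleC :: "complex \<Rightarrow> 'a \<Rightarrow> 'a"  (infixr \<open>*\<^sub>C\<close> 75)

class complex_banach_algebra_1 = real_normed_algebra_1 + banach + scaleC +
  assumes scaleC_add_right: "a *\<^sub>C (x + y) = a *\<^sub>C x + a *\<^sub>C y"
    and scaleC_add_left: "(a + b) *\<^sub>C x = a *\<^sub>C x + b *\<^sub>C x"
    and scaleC_scaleC: "a *\<^sub>C (b *\<^sub>C x) = (a * b) *\<^sub>C x"
    and scaleC_one: "1 *\<^sub>C x = x"
    and scaleR_scaleC: "r *\<^sub>R x = complex_of_real r *\<^sub>C x"
    and mult_scaleC_left: "(a *\<^sub>C x) * y = a *\<^sub>C (x * y)"
    and mult_scaleC_right: "x * (a *\<^sub>C y) = a *\<^sub>C (x * y)"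
    and norm_scaleC: "norm (a *\<^sub>C x) = cmod a * norm x"

definition drazin_invertible :: "'a::complex_banach_algebra_1 \<Rightarrow> bool" where
  "drazin_invertible a \<longleftrightarrow>
     (\<exists>b. a * b = b * a \<and> b * a * b = b \<and> (\<exists>n::nat. (a * (1 - a * b)) ^ n = 0))"

definition exceptional_set :: "(complex \<times> complex \<times> complex) set" where
  "exceptional_set =
     {(a1, a2, 0) | a1 a2. a1 * a2 \<noteq> 0} \<union> {(a1, 0, 0) | a1. a1 \<noteq> 0}"

end

theory Submission
  imports Defs "HOL-Computational_Algebra.Formal_Power_Series"
begin

unbundle no vec_syntax
unbundle fps_syntax

text \<open>
  An element \<open>a\<close> is Drazin invertible iff \<open>X - a\<close> is a unit of the ring of formal Laurent series
  over the algebra, and more generally iff \<open>r - a\<close> is one for any nonzero complex power series \<open>r\<close>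
  without constant term. The hypotheses give
  \<open>(X - x1) (X - x2) (X - x3) = p - q s\<close> with \<open>s = x1 + x2 + x3\<close>, \<open>p = X^3 + \<alpha>1 X\<close> and
  \<open>q = X^2 - \<alpha>2 X + \<beta>\<close>. Outside the exceptional set, \<open>p / q\<close> is a nonzero power series without
  constant term, so the right-hand side is a Laurent unit iff \<open>s\<close> is Drazin invertible. If all but one
  of the four factors in this identity are units, then so is the remaining one.
\<close>

section \<open>Units of formal Laurent series\<close>

text \<open>Invertibility in the ring of formal Laurent series; the inverse is \<open>v / X^n\<close>.\<close>
definition laurent_unit :: "'a::ring_1 fps \<Rightarrow> bool" where
  "laurent_unit u \<longleftrightarrow> (\<exists>v n. u * v = fps_X ^ n \<and> v * u = fps_X ^ n)"

lemma fps_X_power_left_cancel: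
  fixes u v :: "'a::ring_1 fps"
  shows "fps_X ^ n * u = fps_X ^ n * v \<longleftrightarrow> u = v"
proof
  assume "fps_X ^ n * u = fps_X ^ n * v"
  then have "(fps_X ^ n * u) $ (k + n) = (fps_X ^ n * v) $ (k + n)" for k
    by simp
  then show "u = v"
    by (simp add: fps_eq_iff fps_X_power_mult_nth)
qed simp

text \<open>Associativity applied to \<open>w * u * v\<close> gives
  \<open>fps_X ^ m * v = fps_X ^ n * w\<close>, since \<open>fps_X\<close> is central. This common
  series inverts \<open>u\<close> on both sides up to \<open>fps_X ^ (m + n)\<close>, so one-sided
  inverses with different denominators suffice.\<close>

lemma laurent_unitI:
  fixes u v w :: "'a::ring_1 fps"
  assumes uv: "u * v = fps_X ^ n" and wu: "w * u = fps_X ^ m"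
  shows "laurent_unit u"
proof -
  have "fps_X ^ m * v = w * (u * v)"
    by (simp add: wu flip: mult.assoc)
  then have eq: "fps_X ^ m * v = fps_X ^ n * w"
    by (simp add: uv fps_mult_fps_X_power_commute)
  have "u * (fps_X ^ m * v) = fps_X ^ m * (u * v)"
    by (metis fps_mult_fps_X_power_commute mult.assoc)
  then have "u * (fps_X ^ m * v) = fps_X ^ (m + n)"
    by (simp add: uv power_add)
  moreover have "(fps_X ^ m * v) * u = fps_X ^ (m + n)"
    by (simp add: eq wu mult.assoc add.commute flip: power_add)
  ultimately show ?thesis
    unfolding laurent_unit_def by blast
qed

lemma laurent_unit_one: "laurent_unit (1 :: 'a::ring_1 fps)"
  by (rule laurent_unitI[of _ 1 0 1 0]) simp_all

lemma laurent_unit_mult: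
  fixes u v :: "'a::ring_1 fps"
  assumes "laurent_unit u" "laurent_unit v"
  shows "laurent_unit (u * v)"
proof -
  obtain u' n where u: "u * u' = fps_X ^ n" "u' * u = fps_X ^ n"
    using assms(1) unfolding laurent_unit_def by blast
  obtain v' m where v: "v * v' = fps_X ^ m" "v' * v = fps_X ^ m"
    using assms(2) unfolding laurent_unit_def by blast
  have "(u * v) * (v' * u') = u * (v * v') * u'"
    by (simp add: mult.assoc)
  also have "\<dots> = fps_X ^ m * (u * u')"
    by (metis v(1) fps_mult_fps_X_power_commute mult.assoc)
  finally have 1: "(u * v) * (v' * u') = fps_X ^ (m + n)"
    by (simp add: u power_add)
  have "(v' * u') * (u * v) = v' * (u' * u) * v"
    by (simp add: mult.assoc)
  also have "\<dots> = fps_X ^ n * (v' * v)"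
    by (metis u(2) fps_mult_fps_X_power_commute mult.assoc)
  finally have "(v' * u') * (u * v) = fps_X ^ (n + m)"
    by (simp add: v power_add)
  with 1 show ?thesis
    by (rule laurent_unitI)
qed

text \<open>If \<open>t\<close> inverts \<open>u * v * w\<close>, then \<open>w * t * u\<close>
  inverts \<open>v\<close>. Each side is checked after inserting \<open>u' * u\<close> or
  \<open>w * w'\<close>, a power of \<open>fps_X\<close> that is cancelled at the end.\<close>

lemma laurent_unit_middle:
  fixes u v w :: "'a::ring_1 fps"
  assumes "laurent_unit (u * v * w)" "laurent_unit u" "laurent_unit w"
  shows "laurent_unit v"
proof -
  obtain t n where t: "(u * v * w) * t = fps_X ^ n" "t * (u * v * w) = fps_X ^ n"
    using assms(1) unfolding laurent_unit_def by blast
  obtain u' m where u: "u * u' = fps_X ^ m" "u' * u = fps_X ^ m"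
    using assms(2) unfolding laurent_unit_def by blast
  obtain w' k where w: "w * w' = fps_X ^ k" "w' * w = fps_X ^ k"
    using assms(3) unfolding laurent_unit_def by blast
  have "fps_X ^ m * (v * (w * t * u)) = u' * ((u * v * w) * t) * u"
    by (simp add: mult.assoc flip: u(2))
  also have "\<dots> = fps_X ^ n * (u' * u)"
    by (metis t(1) fps_mult_fps_X_power_commute mult.assoc)
  also have "\<dots> = fps_X ^ m * fps_X ^ n"
    by (simp add: u add.commute flip: power_add)
  finally have 1: "v * (w * t * u) = fps_X ^ n"
    by (simp add: fps_X_power_left_cancel)
  have "fps_X ^ k * ((w * t * u) * v) = (w * t * u) * v * (w * w')"
    by (metis w(1) fps_mult_fps_X_power_commute)
  also have "\<dots> = w * (t * (u * v * w)) * w'"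
    by (simp add: mult.assoc)
  also have "\<dots> = fps_X ^ n * (w * w')"
    by (metis t(2) fps_mult_fps_X_power_commute mult.assoc)
  also have "\<dots> = fps_X ^ k * fps_X ^ n"
    by (simp add: w add.commute flip: power_add)
  finally have "(w * t * u) * v = fps_X ^ n"
    by (simp add: fps_X_power_left_cancel)
  with 1 show ?thesis
    by (rule laurent_unitI)
qed

text \<open>\<open>v * t\<close> is a right inverse up to a power of \<open>fps_X\<close>; because
  the factors commute, \<open>t * v\<close> is a left one.\<close>

lemma laurent_unit_commuting_factor:
  fixes u v :: "'a::ring_1 fps"
  assumes "laurent_unit (u * v)" "u * v = v * u"
  shows "laurent_unit u"
proof -
  obtain t n where t: "(u * v) * t = fps_X ^ n" "t * (u * v) = fps_X ^ n"
    using assms(1) unfolding laurent_unit_def by blast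
  have "u * (v * t) = fps_X ^ n"
    using t(1) by (simp add: mult.assoc)
  moreover have "(t * v) * u = fps_X ^ n"
    using t(2) by (simp add: assms(2) mult.assoc)
  ultimately show ?thesis
    by (rule laurent_unitI)
qed

lemma laurent_unit_const_coeff_1:
  fixes u :: "'a::ring_1 fps"
  assumes "u $ 0 = 1"
  shows "laurent_unit u"
proof (rule laurent_unitI)
  show "u * fps_right_inverse u 1 = fps_X ^ 0"
    using fps_right_inverse[of u 1] assms by simp
  show "fps_left_inverse u 1 * u = fps_X ^ 0"
    using fps_left_inverse[of 1 u] assms by simp
qed

section \<open>Complex power series as central elements\<close>

lemma scaleC_zero_left: "0 *\<^sub>C x = (0 :: 'a::complex_banach_algebra_1)"
  using scaleC_add_left[of 0 0 x] by simp

lemma scaleC_sum_left: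
  "(\<Sum>i\<in>I. f i) *\<^sub>C x = (\<Sum>i\<in>I. f i *\<^sub>C (x :: 'a::complex_banach_algebra_1))"
  by (induction I rule: infinite_finite_induct) (simp_all add: scaleC_zero_left scaleC_add_left)

definition fps_of_complex :: "complex fps \<Rightarrow> 'a::complex_banach_algebra_1 fps" where
  "fps_of_complex f = Abs_fps (\<lambda>n. (f $ n) *\<^sub>C 1)"

lemma fps_of_complex_nth [simp]: "fps_of_complex f $ n = (f $ n) *\<^sub>C 1"
  by (simp add: fps_of_complex_def)

lemma fps_of_complex_1 [simp]: "fps_of_complex 1 = 1"
  by (simp add: fps_eq_iff scaleC_zero_left scaleC_one)

lemma fps_of_complex_X [simp]: "fps_of_complex fps_X = fps_X"
  by (simp add: fps_eq_iff fps_X_def scaleC_zero_left scaleC_one)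

lemma fps_of_complex_const [simp]: "fps_of_complex (fps_const c) = fps_const (c *\<^sub>C 1)"
  by (simp add: fps_eq_iff scaleC_zero_left)

lemma fps_of_complex_add [simp]:
  "fps_of_complex (f + g) = fps_of_complex f + fps_of_complex g"
  by (simp add: fps_eq_iff scaleC_add_left)

lemma fps_of_complex_diff [simp]:
  "fps_of_complex (f - g) = fps_of_complex f - fps_of_complex g"
  by (metis diff_add_cancel eq_diff_eq fps_of_complex_add)

lemma fps_of_complex_mult [simp]:
  "fps_of_complex (f * g) = fps_of_complex f * fps_of_complex g"
  by (simp add: fps_eq_iff fps_mult_nth scaleC_sum_left mult_scaleC_left scaleC_scaleC)

lemma fps_of_complex_power [simp]: "fps_of_complex (f ^ n) = fps_of_complex f ^ n"
  by (induction n) simp_all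

lemma fps_of_complex_commute: "fps_of_complex f * u = u * fps_of_complex f"
proof (rule fps_ext)
  fix n
  have "(fps_of_complex f * u) $ n = (\<Sum>i=0..n. (f $ i) *\<^sub>C (u $ (n - i)))"
    by (simp add: fps_mult_nth mult_scaleC_left)
  also have "\<dots> = (\<Sum>i=0..n. (f $ (n - i)) *\<^sub>C (u $ i))"
    by (rule sum.reindex_bij_witness[of _ "\<lambda>i. n - i" "\<lambda>i. n - i"]) auto
  also have "\<dots> = (u * fps_of_complex f) $ n"
    by (simp add: fps_mult_nth mult_scaleC_right)
  finally show "(fps_of_complex f * u) $ n = (u * fps_of_complex f) $ n" .
qed

text \<open>A nonzero series over a field is a power of \<open>fps_X\<close> times a series with
  nonzero constant term, which has an inverse.\<close>

lemma laurent_unit_fps_of_complex: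
  assumes "f \<noteq> 0"
  shows "laurent_unit (fps_of_complex f :: 'a::complex_banach_algebra_1 fps)"
proof -
  define U where "U = unit_factor f"
  have "U $ 0 \<noteq> 0"
    unfolding U_def using assms by simp
  then have "U * inverse U = 1"
    by (rule inverse_mult_eq_1')
  moreover have "f = fps_X ^ subdegree f * U"
    unfolding U_def by (rule fps_unit_factor_decompose')
  ultimately have "f * inverse U = fps_X ^ subdegree f"
    by (metis mult.assoc mult.right_neutral)
  then have "fps_of_complex f * fps_of_complex (inverse U) =
      (fps_X ^ subdegree f :: 'a fps)"
    by (metis fps_of_complex_mult fps_of_complex_power fps_of_complex_X)
  then show ?thesis
    by (metis fps_of_complex_commute laurent_unitI)
qed

section \<open>Drazin invertibility\<close>

lemma power_mult_commuting:
  fixes a b :: "'a::monoid_mult"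
  assumes "a * b = b * a"
  shows "(a * b) ^ n = a ^ n * b ^ n"
proof (induction n)
  case (Suc n)
  have "a * b * (a ^ n * b ^ n) = a * (a ^ n * b) * b ^ n"
    using power_commuting_commutes[OF assms, of n] by (simp add: mult.assoc)
  then show ?case
    using Suc by (simp add: mult.assoc)
qed simp

lemma idempotent_power_Suc:
  fixes e :: "'a::monoid_mult"
  assumes "e * e = e"
  shows "e ^ Suc n = e"
  by (induction n) (simp_all add: assms)

text \<open>The relation iterates to \<open>a ^ m = a ^ (m + k) * c ^ k\<close>. Hence
  \<open>a ^ m * c ^ m\<close> is an idempotent fixing \<open>a ^ m\<close>, and
  \<open>a ^ m * c ^ Suc m\<close> is the Drazin inverse.\<close>

lemma drazin_invertibleI:
  fixes a c :: "'a::complex_banach_algebra_1"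
  assumes comm: "a * c = c * a" and "a ^ n = a ^ Suc n * c"
  shows "drazin_invertible a"
proof -
  \<comment> \<open>A positive exponent is required so that
    \<open>(1 - e) ^ m = 1 - e\<close>.\<close>
  define m where "m = Suc n"
  have m: "a ^ m = a ^ Suc m * c"
    unfolding m_def using assms(2) by (metis mult.assoc power_Suc)
  have ac: "a ^ i * c ^ j = c ^ j * a ^ i" for i j
    by (metis comm power_commuting_commutes)
  have shift: "a ^ m = a ^ (m + k) * c ^ k" for k
  proof (induction k)
    case (Suc k)
    have "a ^ (k + m) = a ^ (k + Suc m) * c"
      by (simp only: power_add mult.assoc flip: m)
    then have "a ^ (m + k) = a ^ (m + Suc k) * c"
      by (simp add: add.commute)
    then show ?case
      using Suc by (metis mult.assoc power_Suc)
  qed simp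
  define e where "e = a ^ m * c ^ m"
  have idem: "e * e = e"
  proof -
    have "e * e = (a ^ (m + m) * c ^ m) * c ^ m"
      unfolding e_def by (metis ac mult.assoc power_add)
    then show ?thesis
      using shift[of m] by (simp add: e_def)
  qed
  have ae: "a ^ m * e = a ^ m"
    using shift[of m] by (simp add: e_def power_add mult.assoc)
  define b where "b = a ^ m * c ^ Suc m"
  have ab: "a * b = e"
    unfolding b_def e_def using m by (metis mult.assoc power_Suc)
  have ba: "b * a = e"
    using ab ac unfolding b_def by (metis mult.assoc power_commutes power_one_right)
  have eb: "e * b = b"
    unfolding b_def using idem unfolding e_def by (metis mult.assoc power_Suc2)
  have "a * e = e * a"
    by (metis ab ba mult.assoc)
  then have "(a * (1 - e)) ^ k = a ^ k * (1 - e) ^ k" for k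
    by (intro power_mult_commuting) (simp add: algebra_simps)
  moreover have "(1 - e) ^ m = 1 - e"
    unfolding m_def by (rule idempotent_power_Suc) (simp add: algebra_simps idem)
  ultimately have "(a * (1 - a * b)) ^ m = a ^ m * (1 - e)"
    by (simp only: ab)
  also have "\<dots> = 0"
    by (simp add: ae right_diff_distrib)
  finally have "(a * (1 - a * b)) ^ m = 0" .
  then show ?thesis
    unfolding drazin_invertible_def using ab ba eb by metis
qed

text \<open>A sufficiently high power kills the nilpotent part \<open>a * (1 - a * b)\<close>, so
  \<open>b ^ n\<close> is a group inverse of \<open>a ^ n\<close>.\<close>

lemma drazin_invertible_power_group_inverse:
  fixes a :: "'a::complex_banach_algebra_1"
  assumes "drazin_invertible a"
  obtains n d where "n > 0" "a ^ n * d = d * a ^ n" "a ^ n * d * a ^ n = a ^ n"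
proof -
  obtain b k where ab: "a * b = b * a" and bab: "b * a * b = b"
    and nil: "(a * (1 - a * b)) ^ k = 0"
    using assms unfolding drazin_invertible_def by blast
  define e where "e = a * b"
  define n where "n = Suc k"
  have idem: "e * e = e"
    unfolding e_def by (metis ab bab mult.assoc)
  have ae: "a * e = e * a"
    unfolding e_def by (metis ab mult.assoc)
  have "a ^ n * (1 - e) ^ n = (a * (1 - e)) ^ n"
    by (rule power_mult_commuting[symmetric]) (simp add: ae algebra_simps)
  also have "\<dots> = 0"
    using nil by (simp add: n_def e_def)
  also have "(1 - e) ^ n = 1 - e"
    unfolding n_def by (rule idempotent_power_Suc) (simp add: algebra_simps idem)
  finally have ane: "a ^ n * e = a ^ n"
    by (simp add: algebra_simps)
  have "e ^ n = e"
    unfolding n_def by (rule idempotent_power_Suc) (rule idem)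
  moreover have "(a * b) ^ n = a ^ n * b ^ n"
    by (rule power_mult_commuting) (rule ab)
  ultimately have en: "a ^ n * b ^ n = e"
    by (simp add: e_def)
  have comm: "a ^ n * b ^ n = b ^ n * a ^ n"
    by (metis ab power_commuting_commutes)
  have "e * a ^ n = a ^ n"
    using ane ae by (metis power_commuting_commutes)
  then show thesis
    using that[of n "b ^ n"] en comm by (simp add: n_def)
qed

section \<open>Drazin invertibility as a Laurent unit condition\<close>

lemma power_diff_factor:
  fixes r :: "'a::ring_1 fps" and s :: 'a
  assumes comm: "r * fps_const s = fps_const s * r" and r0: "r $ 0 = 0"
  obtains h where "r ^ Suc n - fps_const s ^ Suc n = (r - fps_const s) * h"
    "(r - fps_const s) * h = h * (r - fps_const s)" "h $ 0 = s ^ n"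
proof -
  let ?S = "fps_const s"
  \<comment> \<open>Here \<open>h\<close> is the sum of \<open>r ^ i * ?S ^ (n - i)\<close> over
    \<open>i \<le> n\<close>, built recursively. As \<open>r\<close> has no constant term, only
    \<open>i = 0\<close> contributes to \<open>h $ 0\<close>.\<close>
  have "\<exists>h. r ^ Suc n - ?S ^ Suc n = (r - ?S) * h \<and> (r - ?S) * h = h * (r - ?S) \<and> h $ 0 = s ^ n"
  proof (induction n)
    case 0
    show ?case
      by (rule exI[of _ 1]) simp
  next
    case (Suc n)
    then obtain h where h: "r ^ Suc n - ?S ^ Suc n = (r - ?S) * h"
      "(r - ?S) * h = h * (r - ?S)" "h $ 0 = s ^ n"
      by blast
    let ?h = "?S ^ Suc n + r * h"
    have rS: "r * (r - ?S) = (r - ?S) * r"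
      by (simp only: right_diff_distrib left_diff_distrib comm)
    have "?S ^ Suc n * r = r * ?S ^ Suc n"
      by (rule power_commuting_commutes) (rule comm[symmetric])
    then have SS: "(r - ?S) * ?S ^ Suc n = ?S ^ Suc n * (r - ?S)"
      by (simp only: right_diff_distrib left_diff_distrib power_commutes)
    have "r ^ Suc (Suc n) - ?S ^ Suc (Suc n) = (r - ?S) * ?S ^ Suc n + r * (r ^ Suc n - ?S ^ Suc n)"
      by (simp only: right_diff_distrib left_diff_distrib power_Suc[of _ "Suc n"]) simp
    also have "\<dots> = (r - ?S) * ?h"
      unfolding h(1) by (simp only: distrib_left rS flip: mult.assoc)
    finally have 1: "r ^ Suc (Suc n) - ?S ^ Suc (Suc n) = (r - ?S) * ?h" .
    have "(r * h) * (r - ?S) = r * ((r - ?S) * h)"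
      by (simp only: mult.assoc h(2))
    also have "\<dots> = (r - ?S) * (r * h)"
      by (simp only: rS flip: mult.assoc)
    finally have 2: "(r - ?S) * ?h = ?h * (r - ?S)"
      by (simp only: distrib_left distrib_right SS)
    have 3: "?h $ 0 = s ^ Suc n"
      by (simp add: r0)
    show ?case
      using 1 2 3 by blast
  qed
  then show thesis
    using that by blast
qed

text \<open>From a Laurent inverse, one coefficient of the factored power difference yields the
  relation required by \<open>drazin_invertibleI\<close>. Conversely, some power
  \<open>s ^ n\<close> has a group inverse, with which \<open>r ^ n - s ^ n\<close> is inverted
  explicitly; \<open>r - s\<close> is a commuting factor of it.\<close>

lemma laurent_unit_diff_const_iff:
  fixes s :: "'a::complex_banach_algebra_1"
  assumes r: "r \<noteq> 0" "r $ 0 = 0"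
  shows "laurent_unit (fps_of_complex r - fps_const s) \<longleftrightarrow> drazin_invertible s"
proof
  let ?R = "fps_of_complex r :: 'a fps" and ?S = "fps_const s"
  have R0: "?R $ 0 = 0"
    using r by (simp add: scaleC_zero_left)
  have RS: "?R * ?S = ?S * ?R"
    by (rule fps_of_complex_commute)
  {
    assume "laurent_unit (?R - ?S)"
    then obtain g n where g: "(?R - ?S) * g = fps_X ^ n" "g * (?R - ?S) = fps_X ^ n"
      unfolding laurent_unit_def by blast
    \<comment> \<open>Both products of \<open>g\<close> with \<open>?R - ?S\<close> agree and
      \<open>?R\<close> is central, so the \<open>?S\<close> parts agree.\<close>
    have "?S * g = g * ?S"
      using g fps_of_complex_commute[of r g] by (simp add: algebra_simps)
    then have "(?S * g) $ n = (g * ?S) $ n"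
      by (rule arg_cong)
    then have comm: "s * g $ n = g $ n * s"
      by simp
    obtain h where h: "?R ^ Suc n - ?S ^ Suc n = (?R - ?S) * h"
      "(?R - ?S) * h = h * (?R - ?S)" "h $ 0 = s ^ n"
      using power_diff_factor[OF RS R0] by blast
    \<comment> \<open>Compare coefficients at degree \<open>n\<close>: \<open>?R ^ Suc n\<close> is
      divisible by \<open>fps_X ^ Suc n\<close> and drops out, leaving
      \<open>- s ^ Suc n * g $ n = s ^ n\<close>.\<close>
    have "(?R ^ Suc n - ?S ^ Suc n) * g = h * fps_X ^ n"
      by (simp only: h(1,2) mult.assoc g(1))
    then have "(?R ^ Suc n * g) $ n - (?S ^ Suc n * g) $ n = (h * fps_X ^ n) $ n"
      by (metis fps_sub_nth left_diff_distrib)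
    moreover have "(?R ^ Suc n * g) $ n = 0"
    proof -
      have "r = fps_X * fps_shift 1 r"
        using r by (intro fps_ext) (simp add: fps_X_mult_nth)
      then have "r ^ Suc n = fps_X ^ Suc n * fps_shift 1 r ^ Suc n"
        by (metis power_mult_distrib)
      then have "?R ^ Suc n = fps_X ^ Suc n * fps_of_complex (fps_shift 1 r ^ Suc n)"
        by (metis fps_of_complex_mult fps_of_complex_power fps_of_complex_X)
      then show ?thesis
        by (simp only: mult.assoc fps_X_power_mult_nth) simp
    qed
    moreover have "(?S ^ Suc n * g) $ n = s ^ Suc n * g $ n"
      by (simp only: fps_const_power fps_mult_left_const_nth)
    moreover have "(h * fps_X ^ n) $ n = s ^ n"
      by (simp add: fps_X_power_mult_right_nth h(3))
    ultimately have "s ^ n = s ^ Suc n * (- g $ n)"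
      by simp
    moreover have "s * (- g $ n) = (- g $ n) * s"
      using comm by simp
    ultimately show "drazin_invertible s"
      by (intro drazin_invertibleI)
  next
    assume "drazin_invertible s"
    then obtain n d where "n > 0" and ad: "s ^ n * d = d * s ^ n" "s ^ n * d * s ^ n = s ^ n"
      by (rule drazin_invertible_power_group_inverse)
    then obtain k where n: "n = Suc k"
      by (cases n) auto
    define A where "A = fps_const (s ^ n)"
    define D where "D = fps_const d"
    define P where "P = (fps_of_complex (r ^ n) :: 'a fps)"
    have P: "P * u = u * P" for u
      unfolding P_def by (rule fps_of_complex_commute)
    have AD: "A * D = D * A" "A * D * A = A"
      using ad by (simp_all add: A_def D_def)
    \<comment> \<open>\<open>W / (P (1 - P D))\<close> is the Laurent expansion of the inverse of \<open>P - A\<close>: on the range of the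
      idempotent \<open>1 - A D\<close> it is \<open>1 / P\<close>, on that of \<open>A D\<close> it is \<open>- D / (1 - P D)\<close>.\<close>
    define W where "W = 1 - A * D - P * D"
    have "A * (P * D) = P * (A * D)" "A * (A * D) = A"
      using AD by (metis P mult.assoc)+
    \<comment> \<open>The two terms \<open>P * A * D\<close> cancel, and \<open>A * (A * D)\<close>
      cancels \<open>A\<close>; only multiples of \<open>P\<close> remain.\<close>
    then have PAW: "(P - A) * W = P * (1 - P * D)"
      unfolding W_def by (simp add: algebra_simps)
    have PAW_comm: "(P - A) * W = W * (P - A)"
    proof -
      have "A * W = W * A"
        unfolding W_def using AD P[of A] by (simp add: algebra_simps) (metis AD mult.assoc)
      then show ?thesis
        using P[of W] by (simp only: left_diff_distrib right_diff_distrib)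
    qed
    \<comment> \<open>Positivity of \<open>n\<close> enters here: \<open>r ^ n\<close> has no
      constant term.\<close>
    have "(P * D) $ 0 = 0"
      using r by (simp add: P_def n scaleC_zero_left)
    then have "laurent_unit (1 - P * D)"
      by (intro laurent_unit_const_coeff_1) simp
    moreover have "laurent_unit P"
      unfolding P_def using r by (intro laurent_unit_fps_of_complex) simp
    ultimately have "laurent_unit ((P - A) * W)"
      unfolding PAW by (rule laurent_unit_mult[rotated])
    then have PA: "laurent_unit (P - A)"
      using PAW_comm by (rule laurent_unit_commuting_factor)
    obtain h where h: "?R ^ Suc k - ?S ^ Suc k = (?R - ?S) * h" "(?R - ?S) * h = h * (?R - ?S)"
      using power_diff_factor[OF RS R0] by blast
    have "P - A = (?R - ?S) * h"
      unfolding h(1)[symmetric] n P_def A_def fps_of_complex_power fps_const_power ..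
    with PA h(2) show "laurent_unit (?R - ?S)"
      by (metis laurent_unit_commuting_factor)
  }
qed

lemma laurent_unit_X_diff_const_iff:
  "laurent_unit (fps_X - fps_const a) \<longleftrightarrow> drazin_invertible (a :: 'a::complex_banach_algebra_1)"
  using laurent_unit_diff_const_iff[of fps_X a] by simp

section \<open>The product identity and cancellation of its factors\<close>

theorem theorem2p1:
  fixes x1 x2 x3 :: "'a::complex_banach_algebra_1"
    and \<alpha>1 \<alpha>2 \<beta> :: complex
  assumes notM: "(\<alpha>1, \<alpha>2, \<beta>) \<notin> exceptional_set"
    and eq1: "x1 * x2 + x1 * x3 + x2 * x3 = \<alpha>1 *\<^sub>C 1 + \<alpha>2 *\<^sub>C (x1 + x2 + x3)"
    and eq2: "x1 * x2 * x3 = \<beta> *\<^sub>C (x1 + x2 + x3)"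
  shows "(drazin_invertible x1 \<and> drazin_invertible x2 \<and> drazin_invertible x3
            \<longrightarrow> drazin_invertible (x1 + x2 + x3))
       \<and> (drazin_invertible x1 \<and> drazin_invertible x2 \<and> drazin_invertible (x1 + x2 + x3)
            \<longrightarrow> drazin_invertible x3)
       \<and> (drazin_invertible x1 \<and> drazin_invertible x3 \<and> drazin_invertible (x1 + x2 + x3)
            \<longrightarrow> drazin_invertible x2)
       \<and> (drazin_invertible x2 \<and> drazin_invertible x3 \<and> drazin_invertible (x1 + x2 + x3)
            \<longrightarrow> drazin_invertible x1)"
proof -
  define s where "s = x1 + x2 + x3"
  define u where "u x = fps_X - fps_const x" for x :: 'a
  define p :: "complex fps" where "p = fps_X ^ 3 + fps_const \<alpha>1 * fps_X"
  define q :: "complex fps" where "q = fps_X ^ 2 - fps_const \<alpha>2 * fps_X + fps_const \<beta>"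

  \<comment> \<open>Since \<open>fps_X\<close> is central, the expansion keeps the order of the
    \<open>x\<close>'s, so its coefficients are exactly the left-hand sides of \<open>eq1\<close>
    and \<open>eq2\<close>.\<close>
  have prod: "u x1 * u x2 * u x3 = fps_of_complex p - fps_of_complex q * fps_const s"
  proof -
    let ?X = "fps_X :: 'a fps"
    have X: "fps_const c * ?X = ?X * fps_const c"
      "fps_const c * (?X * z) = ?X * (fps_const c * z)" for c z
      by (metis fps_mult_fps_X_commute, metis fps_mult_fps_X_commute mult.assoc)
    have "u x1 * u x2 * u x3 = ?X ^ 3 - ?X ^ 2 * fps_const s
        + ?X * fps_const (x1 * x2 + x1 * x3 + x2 * x3) - fps_const (x1 * x2 * x3)"
      unfolding s_def
      by (simp add: u_def algebra_simps X power2_eq_square power3_eq_cube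
          flip: fps_const_add fps_const_mult)
    also have "\<dots> = ?X ^ 3 - ?X ^ 2 * fps_const s
        + ?X * (fps_const (\<alpha>1 *\<^sub>C 1) + fps_const (\<alpha>2 *\<^sub>C 1) * fps_const s)
        - fps_const (\<beta> *\<^sub>C 1) * fps_const s"
      unfolding eq1 eq2 s_def[symmetric] by (simp add: mult_scaleC_left)
    also have "\<dots> = fps_of_complex p - fps_of_complex q * fps_const s"
      by (simp add: p_def q_def algebra_simps X del: fps_const_mult)
    finally show ?thesis .
  qed

  \<comment> \<open>The exceptional set is exactly \<open>\<beta> = 0\<close>,
    \<open>\<alpha>1 \<noteq> 0\<close>. There \<open>p\<close> has order 1 and \<open>q\<close>
    order at least 1, so \<open>p / q\<close> could not be a power series vanishing at 0.\<close>
  obtain r where r: "p = q * r" "r \<noteq> 0" "r $ 0 = 0" and q: "q \<noteq> 0"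
  proof (cases "\<beta> = 0")
    case False
    then have q0: "q $ 0 \<noteq> 0"
      by (simp add: q_def)
    have "p $ 3 = 1"
      by (simp add: p_def fps_X_power_iff)
    then have "p \<noteq> 0"
      by auto
    show thesis
    proof
      show "p = q * (p * inverse q)"
        using inverse_mult_eq_1'[OF q0] by (metis mult.left_commute mult.right_neutral)
      then show "p * inverse q \<noteq> 0"
        using \<open>p \<noteq> 0\<close> by (metis mult_zero_right)
      show "(p * inverse q) $ 0 = 0"
        by (simp add: p_def)
      show "q \<noteq> 0"
        using q0 by auto
    qed
  next
    case True
    with notM have [simp]: "\<alpha>1 = 0"
      by (auto simp: exceptional_set_def)
    show thesis
    proof (cases "\<alpha>2 = 0")
      case \<alpha>2: True
      show thesis
        by (rule that[of fps_X]) (simp_all add: p_def q_def True \<alpha>2 power2_eq_square power3_eq_cube)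
    next
      case False
      \<comment> \<open>Now \<open>p = fps_X ^ 3\<close> and \<open>q = fps_X * t\<close> with
        \<open>t\<close> invertible, so \<open>r\<close> is \<open>fps_X ^ 2 / t\<close>.\<close>
      define t where "t = fps_X - fps_const \<alpha>2"
      have t0: "t $ 0 \<noteq> 0"
        using False by (simp add: t_def)
      have q: "q = fps_X * t"
        by (simp add: q_def t_def True power2_eq_square algebra_simps)
      have "t * inverse t = 1"
        using t0 by (rule inverse_mult_eq_1')
      then have p: "p = q * (fps_X ^ 2 * inverse t)"
        by (simp add: p_def q power2_eq_square power3_eq_cube mult_ac)
      show thesis
      proof
        show "p = q * (fps_X ^ 2 * inverse t)"
          by (rule p)
        have "p \<noteq> 0"
          by (simp add: p_def)
        then show "fps_X ^ 2 * inverse t \<noteq> 0" "q \<noteq> 0"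
          using p by auto
        show "(fps_X ^ 2 * inverse t) $ 0 = 0"
          by simp
      qed
    qed
  qed

  define v where "v = fps_of_complex r - fps_const s"
  have prod': "u x1 * u x2 * u x3 = fps_of_complex q * v"
    by (simp add: prod r(1) v_def right_diff_distrib)
  have uq: "laurent_unit (fps_of_complex q :: 'a fps)"
    using q by (rule laurent_unit_fps_of_complex)
  have u: "laurent_unit (u x) \<longleftrightarrow> drazin_invertible x" for x
    unfolding u_def by (rule laurent_unit_X_diff_const_iff)
  have v: "laurent_unit v \<longleftrightarrow> drazin_invertible s"
    unfolding v_def using r by (intro laurent_unit_diff_const_iff)
  have left: "laurent_unit b" if "laurent_unit (a * b)" "laurent_unit a" for a b :: "'a fps"
    using laurent_unit_middle[of a b 1] that by (simp add: laurent_unit_one)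
  have right: "laurent_unit a" if "laurent_unit (a * b)" "laurent_unit b" for a b :: "'a fps"
    using laurent_unit_middle[of 1 a b] that by (simp add: laurent_unit_one)
  \<comment> \<open>The scalar factor \<open>q\<close> is always a Laurent unit, so it can be
    multiplied in or cancelled. All four implications then concern a product of three
    factors.\<close>
  have v_iff: "drazin_invertible s \<longleftrightarrow> laurent_unit (u x1 * u x2 * u x3)"
    unfolding v[symmetric] prod' using left[OF _ uq] laurent_unit_mult[OF uq] by blast
  have "drazin_invertible s" if "drazin_invertible x1" "drazin_invertible x2" "drazin_invertible x3"
    unfolding v_iff using that by (intro laurent_unit_mult) (simp_all add: u)
  moreover have "drazin_invertible x3"
    if "drazin_invertible x1" "drazin_invertible x2" "drazin_invertible s"
    using that left[of "u x1 * u x2" "u x3"] laurent_unit_mult[of "u x1" "u x2"]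
    by (simp add: v_iff u)
  moreover have "drazin_invertible x2"
    if "drazin_invertible x1" "drazin_invertible x3" "drazin_invertible s"
    using that laurent_unit_middle[of "u x1" "u x2" "u x3"] by (simp add: v_iff u)
  moreover have "drazin_invertible x1"
    if "drazin_invertible x2" "drazin_invertible x3" "drazin_invertible s"
    using that right[of "u x1" "u x2 * u x3"] laurent_unit_mult[of "u x2" "u x3"]
    by (simp add: v_iff u mult.assoc)
  ultimately show ?thesis
    unfolding s_def by blast
qed

end
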